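(* Let $\mathcal{F} \subseteq {}^{\omega}\omega$ be a maximal eventually different family. Then $\mathcal{F}$ can be restricted to a Van Douwen family (i.e. there is an infinite $A \subseteq \omega$ such that $\mathcal{F} \restriction A$ is Van Douwen) if and only if $\mathcal{I}_0(\mathcal{F})$ is not a tall ideal.
   Context: For countable sets $A,B$ and $f,g \in {}^{A}B$ (functions from $A$ to $B$) let $E(f,g) := \{a \in A \mid f(a) = g(a)\}$; $f$ and $g$ are eventually different if $E(f,g)$ is finite. A family $\mathcal{F} \subseteq {}^{A}B$ is eventually different (ed) if its members are pairwise eventually different, and it is maximal eventually different (med) if it is maximal with respect to inclusion among ed families contained in ${}^{A}B$. For a family $\mathcal{F}$ of functions with domain containing $A$, $\mathcal{F}\restriction A := \{f\restriction A \mid f \in \mathcal{F}\}$. For an infinite $A \subseteq \omega$, a med family $\mathcal{F} \subseteq {}^{A}\omega$ is Van Douwen if for every infinite $A' \subseteq A$ the family $\mathcal{F}\restriction A'$ is a med family in ${}^{A'}\omega$. $\mathrm{Fin}$ is the ideal of finite subsets of $\omega$. For an ed family $\mathcal{F} \subseteq {}^{\omega}\omega$, its associated ideal is $\mathcal{I}_0(\mathcal{F}) := \{A \subseteq \omega \text{ infinite} \mid \mathcal{F} \restriction A \text{ is not a maximal ed family in } {}^{A}\omega\} \cup \mathrm{Fin}$. An ideal $\mathcal{I}$ on $\omega$ is tall if for every infinite $A \subseteq \omega$ there is $B \in \mathcal{I}$ with $A \cap B$ infinite. *)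

theory Defs
  imports Main "HOL-Library.FuncSet"
begin

text \<open>
  The set of functions from \<open>A\<close> to \<open>B\<close> is the library's \<open>A \<rightarrow>\<^sub>E B\<close>: functions that are
  \<open>undefined\<close> outside \<open>A\<close>, so that equality is equality on \<open>A\<close>. For \<open>A = UNIV\<close>, \<open>B = UNIV\<close> this
  is the whole function type.
\<close>

definition agreement_set :: "'a set \<Rightarrow> ('a \<Rightarrow> 'b) \<Rightarrow> ('a \<Rightarrow> 'b) \<Rightarrow> 'a set" where
  "agreement_set A f g = {a \<in> A. f a = g a}"

definition eventually_different :: "'a set \<Rightarrow> ('a \<Rightarrow> 'b) \<Rightarrow> ('a \<Rightarrow> 'b) \<Rightarrow> bool" where
  "eventually_different A f g \<longleftrightarrow> finite (agreement_set A f g)"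

text \<open>\<open>pairwise\<close> only concerns distinct members of the family.\<close>

definition ed_family :: "'a set \<Rightarrow> 'b set \<Rightarrow> ('a \<Rightarrow> 'b) set \<Rightarrow> bool" where
  "ed_family A B F \<longleftrightarrow> F \<subseteq> (A \<rightarrow>\<^sub>E B) \<and> pairwise (eventually_different A) F"

definition med_family :: "'a set \<Rightarrow> 'b set \<Rightarrow> ('a \<Rightarrow> 'b) set \<Rightarrow> bool" where
  "med_family A B F \<longleftrightarrow>
     ed_family A B F \<and> (\<forall>G. ed_family A B G \<and> F \<subseteq> G \<longrightarrow> G = F)"

definition restrict_family :: "('a \<Rightarrow> 'b) set \<Rightarrow> 'a set \<Rightarrow> ('a \<Rightarrow> 'b) set" where
  "restrict_family F A = (\<lambda>f. restrict f A) ` F"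

definition van_douwen :: "nat set \<Rightarrow> (nat \<Rightarrow> nat) set \<Rightarrow> bool" where
  "van_douwen A F \<longleftrightarrow>
     infinite A \<and> med_family A UNIV F \<and>
     (\<forall>A'. A' \<subseteq> A \<and> infinite A' \<longrightarrow> med_family A' UNIV (restrict_family F A'))"

definition Fin :: "nat set set" where
  "Fin = {A. finite A}"

definition associated_ideal :: "(nat \<Rightarrow> nat) set \<Rightarrow> nat set set" where
  "associated_ideal F =
     {A. infinite A \<and> \<not> med_family A UNIV (restrict_family F A)} \<union> Fin"

text \<open>
  As usual in this area, ideals on the natural numbers are proper and contain all finite sets.
\<close>

definition ideal_on_nat :: "nat set set \<Rightarrow> bool" where
  "ideal_on_nat I \<longleftrightarrow>
     Fin \<subseteq> I \<and> UNIV \<notin> I \<and>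
     (\<forall>A\<in>I. \<forall>B. B \<subseteq> A \<longrightarrow> B \<in> I) \<and>
     (\<forall>A\<in>I. \<forall>B\<in>I. A \<union> B \<in> I)"

definition tall_ideal :: "nat set set \<Rightarrow> bool" where
  "tall_ideal I \<longleftrightarrow>
     ideal_on_nat I \<and> (\<forall>A. infinite A \<longrightarrow> (\<exists>B\<in>I. infinite (A \<inter> B)))"

end

theory Submission
  imports Defs
begin

text \<open>
  The proof rests on one reformulation of the associated ideal: a set \<open>A\<close>, finite or infinite,
  belongs to it iff a single function \<open>g\<close> agrees with each member of \<open>F\<close> at only finitely many
  points of \<open>A\<close> (\<open>associated_ideal_iff\<close>). For infinite \<open>A\<close> such a \<open>g\<close> is precisely a witness that
  the restricted family can be enlarged; for finite \<open>A\<close> any function will do.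

  This form shows that the associated ideal is an ideal: a witness for \<open>A\<close> is one
  for every subset of \<open>A\<close>; witnesses for \<open>A\<close> and \<open>B\<close> can be glued along \<open>A\<close> to one for the union;
  and a witness for the whole of \<open>\<omega>\<close> would contradict the maximality of \<open>F\<close>. Failure of tallness
  therefore means that some infinite \<open>A\<close> has finite intersection with every member of the ideal.
  By closure under subsets, this says that no infinite subset of \<open>A\<close> is in the ideal, that is,
  that \<open>F\<close> stays maximal on every infinite subset of \<open>A\<close>.
\<close>

lemma restrict_family_restrict_family:
  assumes "A' \<subseteq> A"
  shows "restrict_family (restrict_family F A) A' = restrict_family F A'"
  using assms by (simp add: restrict_family_def image_image Int_absorb1)

lemma agreement_set_mono:
  "A \<subseteq> B \<Longrightarrow> agreement_set A f g \<subseteq> agreement_set B f g"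
  by (auto simp: agreement_set_def)

lemma agreement_set_cong:
  assumes "\<And>a. a \<in> A \<Longrightarrow> f a = f' a" "\<And>a. a \<in> A \<Longrightarrow> g a = g' a"
  shows "agreement_set A f g = agreement_set A f' g'"
  using assms by (auto simp: agreement_set_def)

lemma agreement_set_commute: "agreement_set A f g = agreement_set A g f"
  by (auto simp: agreement_set_def)

lemma ed_family_restrict_family:
  assumes "ed_family B UNIV F" "A \<subseteq> B"
  shows "ed_family A UNIV (restrict_family F A)"
  unfolding ed_family_def
proof
  show "restrict_family F A \<subseteq> A \<rightarrow>\<^sub>E UNIV"
    by (auto simp: restrict_family_def)
  have "eventually_different A (restrict f A) (restrict f' A)"
    if "f \<in> F" "f' \<in> F" "restrict f A \<noteq> restrict f' A" for f f'
  proof -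
    have "f \<noteq> f'"
      using that by auto
    then have "finite (agreement_set B f f')"
      using assms that by (auto simp: ed_family_def pairwise_def eventually_different_def)
    then have "finite (agreement_set A f f')"
      by (rule finite_subset[OF agreement_set_mono[OF assms(2)]])
    also have "agreement_set A f f' = agreement_set A (restrict f A) (restrict f' A)"
      by (rule agreement_set_cong) simp_all
    finally show ?thesis
      by (simp add: eventually_different_def)
  qed
  then show "pairwise (eventually_different A) (restrict_family F A)"
    by (auto simp: restrict_family_def pairwise_def)
qed

text \<open>
  On an infinite domain a function agrees with itself infinitely often, so a function that is
  eventually different from all members of a family is automatically a new one. Values outside
  the domain do not affect agreement, so the function can be restricted before it is added.
\<close>

lemma med_family_iff:
  assumes "infinite A" "ed_family A UNIV F"
  shows "med_family A UNIV F \<longleftrightarrow> \<not> (\<exists>g. \<forall>f\<in>F. eventually_different A f g)"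
proof
  assume med: "med_family A UNIV F"
  show "\<not> (\<exists>g. \<forall>f\<in>F. eventually_different A f g)"
  proof
    assume "\<exists>g. \<forall>f\<in>F. eventually_different A f g"
    then obtain g where g: "\<And>f. f \<in> F \<Longrightarrow> finite (agreement_set A f g)"
      by (auto simp: eventually_different_def)
    define h where "h = restrict g A"
    have h: "finite (agreement_set A f h)" if "f \<in> F" for f
    proof -
      have "agreement_set A f g = agreement_set A f h"
        by (rule agreement_set_cong) (simp_all add: h_def)
      then show ?thesis
        using g[OF that] by simp
    qed
    moreover from this have "finite (agreement_set A h f)" if "f \<in> F" for f
      using that agreement_set_commute[of A h f] by simp
    moreover have "h \<in> A \<rightarrow>\<^sub>E UNIV"
      by (simp add: h_def)
    ultimately have "ed_family A UNIV (insert h F)"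
      using assms(2) by (simp add: ed_family_def pairwise_insert eventually_different_def)
    then have "h \<in> F"
      using med by (auto simp: med_family_def)
    then have "finite (agreement_set A h h)"
      by (rule h)
    then show False
      using assms(1) by (simp add: agreement_set_def)
  qed
next
  assume nex: "\<not> (\<exists>g. \<forall>f\<in>F. eventually_different A f g)"
  have "G \<subseteq> F" if G: "ed_family A UNIV G" "F \<subseteq> G" for G
  proof
    fix g assume "g \<in> G"
    obtain f where "f \<in> F" "\<not> eventually_different A f g"
      using nex by blast
    moreover from this have "f = g"
      using G \<open>g \<in> G\<close> by (auto simp: ed_family_def pairwise_def)
    ultimately show "g \<in> F"
      by simp
  qed
  then show "med_family A UNIV F"
    using assms(2) by (auto simp: med_family_def)
qed

lemma associated_ideal_iff:
  assumes "ed_family UNIV UNIV F"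
  shows "A \<in> associated_ideal F \<longleftrightarrow> (\<exists>g. \<forall>f\<in>F. finite (agreement_set A f g))"
proof (cases "finite A")
  case True
  then show ?thesis
    by (auto simp: associated_ideal_def Fin_def agreement_set_def)
next
  case False
  have "eventually_different A (restrict f A) g \<longleftrightarrow> finite (agreement_set A f g)"
    for f g :: "nat \<Rightarrow> nat"
  proof -
    have "agreement_set A (restrict f A) g = agreement_set A f g"
      by (rule agreement_set_cong) simp_all
    then show ?thesis
      by (simp add: eventually_different_def)
  qed
  then show ?thesis
    using False med_family_iff[OF False ed_family_restrict_family[OF assms subset_UNIV]]
    by (simp add: associated_ideal_def Fin_def restrict_family_def)
qed

lemma associated_ideal_subset:
  assumes "ed_family UNIV UNIV F" "A \<in> associated_ideal F" "B \<subseteq> A"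
  shows "B \<in> associated_ideal F"
proof -
  have "finite (agreement_set B f g)" if "finite (agreement_set A f g)" for f g
    using that by (rule finite_subset[OF agreement_set_mono[OF assms(3)]])
  then show ?thesis
    using assms(2) unfolding associated_ideal_iff[OF assms(1)] by blast
qed

lemma associated_ideal_Un:
  assumes "ed_family UNIV UNIV F" "A \<in> associated_ideal F" "B \<in> associated_ideal F"
  shows "A \<union> B \<in> associated_ideal F"
proof -
  obtain g h where g: "\<And>f. f \<in> F \<Longrightarrow> finite (agreement_set A f g)"
    and h: "\<And>f. f \<in> F \<Longrightarrow> finite (agreement_set B f h)"
    using assms(2,3) unfolding associated_ideal_iff[OF assms(1)] by blast
  have "agreement_set (A \<union> B) f (\<lambda>a. if a \<in> A then g a else h a)
      \<subseteq> agreement_set A f g \<union> agreement_set B f h" for f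
    by (auto simp: agreement_set_def)
  then have "finite (agreement_set (A \<union> B) f (\<lambda>a. if a \<in> A then g a else h a))" if "f \<in> F" for f
    using g[OF that] h[OF that] by (rule finite_subset[OF _ finite_UnI])
  then show ?thesis
    unfolding associated_ideal_iff[OF assms(1)] by blast
qed

lemma ideal_associated_ideal:
  assumes "med_family UNIV UNIV F"
  shows "ideal_on_nat (associated_ideal F)"
proof -
  have ed: "ed_family UNIV UNIV F"
    using assms by (simp add: med_family_def)
  have "UNIV \<notin> associated_ideal F"
    using assms med_family_iff[OF infinite_UNIV_nat ed]
    by (simp add: associated_ideal_iff[OF ed] eventually_different_def)
  moreover have "Fin \<subseteq> associated_ideal F"
    by (simp add: associated_ideal_def)
  ultimately show ?thesis
    using associated_ideal_subset[OF ed] associated_ideal_Un[OF ed]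
    unfolding ideal_on_nat_def by blast
qed

lemma van_douwen_restrict_family_iff:
  assumes "infinite A"
  shows "van_douwen A (restrict_family F A) \<longleftrightarrow>
    (\<forall>A'. A' \<subseteq> A \<and> infinite A' \<longrightarrow> A' \<notin> associated_ideal F)"
proof -
  have "van_douwen A (restrict_family F A) \<longleftrightarrow>
    (\<forall>A'. A' \<subseteq> A \<and> infinite A' \<longrightarrow> med_family A' UNIV (restrict_family F A'))"
    using assms restrict_family_restrict_family[of _ A F] by (auto simp: van_douwen_def)
  then show ?thesis
    by (auto simp: associated_ideal_def Fin_def)
qed

theorem proposition3p2:
  fixes F :: "(nat \<Rightarrow> nat) set"
  assumes "med_family UNIV UNIV F"
  shows "(\<exists>A. infinite A \<and> van_douwen A (restrict_family F A)) \<longleftrightarrow>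
         \<not> tall_ideal (associated_ideal F)"
proof -
  have ed: "ed_family UNIV UNIV F"
    using assms by (simp add: med_family_def)
  have "van_douwen A (restrict_family F A) \<longleftrightarrow> (\<forall>B\<in>associated_ideal F. finite (A \<inter> B))"
    if inf: "infinite A" for A
    unfolding van_douwen_restrict_family_iff[OF inf]
  proof
    assume none: "\<forall>A'. A' \<subseteq> A \<and> infinite A' \<longrightarrow> A' \<notin> associated_ideal F"
    show "\<forall>B\<in>associated_ideal F. finite (A \<inter> B)"
    proof
      fix B assume "B \<in> associated_ideal F"
      then have "A \<inter> B \<in> associated_ideal F"
        by (rule associated_ideal_subset[OF ed]) simp
      then show "finite (A \<inter> B)"
        using none Int_lower1 by blast
    qed
  next
    assume fin: "\<forall>B\<in>associated_ideal F. finite (A \<inter> B)"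
    show "\<forall>A'. A' \<subseteq> A \<and> infinite A' \<longrightarrow> A' \<notin> associated_ideal F"
      using fin by (metis Int_absorb1)
  qed
  then have "(\<exists>A. infinite A \<and> van_douwen A (restrict_family F A)) \<longleftrightarrow>
      (\<exists>A. infinite A \<and> (\<forall>B\<in>associated_ideal F. finite (A \<inter> B)))"
    by meson
  also have "\<dots> \<longleftrightarrow> \<not> tall_ideal (associated_ideal F)"
    using ideal_associated_ideal[OF assms] by (simp add: tall_ideal_def)
  finally show ?thesis .
qed

end
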